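(* Let $(K,P,N)$ and $(\hat K,\hat P,\hat N)$ be finite elements of the same class $C^k$, with $\dim P=\nu$, let $F:K\to\hat K$ be an invertible affine mapping with $F(K)=\hat K$, and suppose that $F^*(\hat P)=P$. Let $N^c=\{n_i^c\}_{i=1}^\mu\subset C_b^k(K)'$ and $\hat N^c=\{\hat n_i^c\}_{i=1}^\mu\subset C_b^k(\hat K)'$ form a compatible nodal completion of $N$ and $\hat N$. Let - $E\in\mathbb{R}^{\nu\times\mu}$ be the Boolean matrix with $E_{ij}=1$ if $\hat n_i=\hat n_j^c$ and $E_{ij}=0$ otherwise, so that $\hat N=E\hat N^c$; - $V^c\in\mathbb{R}^{\mu\times\mu}$ be a matrix with $\hat N^c=V^cF_*(N^c)$; - $D\in\mathbb{R}^{\mu\times\nu}$ be a matrix with $\pi N^c=D\,\pi N$. Then the nodal transformation matrix $V\in\mathbb{R}^{\nu\times\nu}$, determined by $\hat\pi\hat N=VF_*(\pi N)$, satisfies $$V=E\,V^c\,D.$$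
   Context: For a bounded domain $\Omega\subset\mathbb{R}^d$, $C_b^k(\Omega)$ is the space of functions on $\Omega$ with continuous and bounded derivatives up to and including order $k$, and $C_b^k(\Omega)'$ is its topological dual. A finite element (of class $C^k$) is a triple $(K,P,N)$ where $K\subset\mathbb{R}^d$ is a bounded domain, $P\subset C_b^k(K)$ is a finite-dimensional function space of dimension $\nu$, and $N=\{n_i\}_{i=1}^\nu\subset C_b^k(K)'$ is a (fixed, ordered) collection of linearly independent functionals (nodes) whose restrictions to $P$ form a basis of $P'$. Finite collections of functionals (enumerated without repetition) are also regarded as column vectors, and a matrix of numbers acts on such a vector by the usual matrix-vector rule. The same notation with hats is used for the reference element $(\hat K,\hat P,\hat N)$. For $n\in C_b^k(K)'$, $\pi n\in P'$ denotes the restriction of $n$ to $P$; for $\hat n\in C_b^k(\hat K)'$, $\hat\pi\hat n\in\hat P'$ denotes the restriction of $\hat n$ to $\hat P$; both act entrywise on vectors. The pull-back $F^*:C_b^k(\hat K)\to C_b^k(K)$ is $F^*(\hat f)=\hat f\circ F$, and the push-forward is $F_*(n)=n\circ F^*$, mapping $C_b^k(K)'$ to $C_b^k(\hat K)'$ and, by the same formula, $P'$ to $\hat P'$; both act entrywise on vectors. Compatible nodal completion: given $F^*(\hat P)=P$, sets $N^c=\{n^c_i\}_{i=1}^\mu\subset C_b^k(K)'$ and $\hat N^c=\{\hat n^c_i\}_{i=1}^\mu\subset C_b^k(\hat K)'$ form a compatible nodal completion of $N$ and $\hat N$ if (as sets) $N\subset N^c$ and $\hat N\subset\hat N^c$,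 and $\mathrm{span}(F_*(N^c))=\mathrm{span}(\hat N^c)$ in $C_b^k(\hat K)'$. Under these hypotheses $\hat\pi\hat N$ and $F_*(\pi N)$ are both bases of $\hat P'$, so $V$ exists and is unique; matrices $V^c$ and $D$ as described exist. *)

theory Defs
  imports
    "HOL-Analysis.Analysis"
    "HOL-Library.Function_Algebras"
    "Jordan_Normal_Form.Matrix"
begin

text \<open>
  A real function on a set, and likewise a functional on a set of functions, is represented by the
  total function that extends it by \<open>0\<close>.  So two functions on the same set agree iff their
  representatives are equal, and \<open>fun_vs\<close> provides linear algebra for functions and functionals.
\<close>

global_interpretation fun_vs: vector_space "\<lambda>(c::real) (f::'a \<Rightarrow> real) x. c * f x"
  by unfold_locales (auto simp: fun_eq_iff algebra_simps)

definition restrict0 :: "'a set \<Rightarrow> ('a \<Rightarrow> real) \<Rightarrow> 'a \<Rightarrow> real" where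
  "restrict0 A f = (\<lambda>x. if x \<in> A then f x else 0)"


section \<open>The space of functions with bounded continuous derivatives\<close>

type_synonym 'd scalar_fun = "real ^ 'd \<Rightarrow> real"
type_synonym 'd functional = "'d scalar_fun \<Rightarrow> real"

definition bounded_domain :: "(real ^ 'd) set \<Rightarrow> bool" where
  "bounded_domain \<Omega> \<longleftrightarrow> open \<Omega> \<and> connected \<Omega> \<and> \<Omega> \<noteq> {} \<and> bounded \<Omega>"

definition partial_deriv :: "'d::finite \<Rightarrow> 'd scalar_fun \<Rightarrow> 'd scalar_fun" where
  "partial_deriv i f = (\<lambda>x. frechet_derivative f (at x) (axis i 1))"

definition iter_partial :: "'d::finite list \<Rightarrow> 'd scalar_fun \<Rightarrow> 'd scalar_fun" where
  "iter_partial is f = foldr partial_deriv is f"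

text \<open>
  Meaningful for open \<open>\<Omega>\<close> only, where the iterated partial derivatives at points of \<open>\<Omega>\<close> do not
  depend on the values outside \<open>\<Omega>\<close>.
\<close>

definition Cb :: "nat \<Rightarrow> (real ^ 'd::finite) set \<Rightarrow> 'd scalar_fun set" where
  "Cb k \<Omega> = {f. (\<forall>x. x \<notin> \<Omega> \<longrightarrow> f x = 0)
     \<and> (\<forall>is. length is < k \<longrightarrow> iter_partial is f differentiable_on \<Omega>)
     \<and> (\<forall>is. length is \<le> k \<longrightarrow>
          continuous_on \<Omega> (iter_partial is f) \<and> bounded (iter_partial is f ` \<Omega>))}"

definition Cb_norm :: "nat \<Rightarrow> (real ^ 'd::finite) set \<Rightarrow> 'd scalar_fun \<Rightarrow> real" where
  "Cb_norm k \<Omega> f = (SUP (is, x) \<in> {is. length is \<le> k} \<times> \<Omega>. \<bar>iter_partial is f x\<bar>)"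

text \<open>
  The topological dual of a linear subspace \<open>X\<close> of \<open>Cb k \<Omega>\<close>, with respect to the \<open>Cb\<close> norm.
\<close>

definition top_dual :: "nat \<Rightarrow> (real ^ 'd::finite) set \<Rightarrow> 'd scalar_fun set \<Rightarrow> 'd functional set" where
  "top_dual k \<Omega> X = {n. (\<forall>f. f \<notin> X \<longrightarrow> n f = 0)
     \<and> (\<forall>f\<in>X. \<forall>g\<in>X. n (f + g) = n f + n g)
     \<and> (\<forall>c. \<forall>f\<in>X. n (\<lambda>x. c * f x) = c * n f)
     \<and> (\<exists>C. \<forall>f\<in>X. \<bar>n f\<bar> \<le> C * Cb_norm k \<Omega> f)}"


section \<open>Finite elements and their transformation\<close>

text \<open>
  An ordered collection of functionals is a list; by \<open>distinct\<close>, linear independence of its set of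
  members is linear independence of the family.
\<close>

definition finite_element ::
  "nat \<Rightarrow> (real ^ 'd::finite) set \<Rightarrow> 'd scalar_fun set \<Rightarrow> 'd functional list \<Rightarrow> bool" where
  "finite_element k K P N \<longleftrightarrow>
     bounded_domain K
     \<and> P \<subseteq> Cb k K \<and> (\<exists>B. finite B \<and> fun_vs.span B = P) \<and> length N = fun_vs.dim P
     \<and> set N \<subseteq> top_dual k K (Cb k K) \<and> distinct N \<and> fun_vs.independent (set N)
     \<and> distinct (map (restrict0 P) N)
     \<and> fun_vs.independent (restrict0 P ` set N)
     \<and> fun_vs.span (restrict0 P ` set N) = top_dual k K P"

definition affine_map_on :: "(real ^ 'd::finite) set \<Rightarrow> (real ^ 'd \<Rightarrow> real ^ 'd) \<Rightarrow> bool" where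
  "affine_map_on K F \<longleftrightarrow> (\<exists>L b. linear L \<and> (\<forall>x\<in>K. F x = L x + b))"

definition pull_back ::
  "(real ^ 'd) set \<Rightarrow> (real ^ 'd \<Rightarrow> real ^ 'd) \<Rightarrow> 'd scalar_fun \<Rightarrow> 'd scalar_fun" where
  "pull_back K F f = restrict0 K (f \<circ> F)"

text \<open>
  The argument \<open>X\<close> is the space on which the image functional lives: \<open>Cb k K'\<close> for the push-forward
  of functionals on \<open>Cb k K\<close>, and \<open>P'\<close> for that of functionals on \<open>P\<close>, where \<open>K'\<close> and \<open>P'\<close> belong
  to the reference element.
\<close>

definition push_forward ::
  "(real ^ 'd) set \<Rightarrow> (real ^ 'd \<Rightarrow> real ^ 'd) \<Rightarrow> 'd scalar_fun set \<Rightarrow> 'd functional \<Rightarrow> 'd functional" where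
  "push_forward K F X n = restrict0 X (n \<circ> pull_back K F)"

definition mat_act :: "real mat \<Rightarrow> ('a \<Rightarrow> real) list \<Rightarrow> ('a \<Rightarrow> real) list" where
  "mat_act A ns = map (\<lambda>i f. \<Sum>j<dim_col A. A $$ (i, j) * (ns ! j) f) [0..<dim_row A]"

definition compatible_nodal_completion ::
  "nat \<Rightarrow> (real ^ 'd::finite) set \<Rightarrow> (real ^ 'd) set \<Rightarrow> (real ^ 'd \<Rightarrow> real ^ 'd) \<Rightarrow>
   'd functional list \<Rightarrow> 'd functional list \<Rightarrow> 'd functional list \<Rightarrow> 'd functional list \<Rightarrow> bool" where
  "compatible_nodal_completion k K K' F N N' Nc Nc' \<longleftrightarrow>
     set Nc \<subseteq> top_dual k K (Cb k K) \<and> set Nc' \<subseteq> top_dual k K' (Cb k K')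
     \<and> distinct Nc \<and> distinct Nc' \<and> length Nc = length Nc'
     \<and> set N \<subseteq> set Nc \<and> set N' \<subseteq> set Nc'
     \<and> fun_vs.span (push_forward K F (Cb k K') ` set Nc) = fun_vs.span (set Nc')"

end

theory Submission
  imports Defs
begin

text \<open>
  Every functional on the physical element can be transported to the reference element in two ways
  that give the same functional on \<open>P'\<close>: push it forward and then restrict it to \<open>P'\<close>, or restrict
  it to \<open>P\<close> and then push it forward (lemma \<open>restrict0_push_forward\<close>).  Restriction and
  push-forward are linear, so they commute with the action of a matrix on a vector of functionals
  (lemmas \<open>map_restrict0_mat_act\<close> and \<open>map_push_forward_mat_act\<close>).  Writing \<open>F\<^sub>*\<close> for the
  push-forward, this gives

    \<open>\<pi>' N' = E (\<pi>' Nc') = E Vc (\<pi>' (F\<^sub>* Nc)) = E Vc (F\<^sub>* (\<pi> Nc)) = E Vc D (F\<^sub>* (\<pi> N))\<close>,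

  where \<open>\<pi>\<close> and \<open>\<pi>'\<close> are the restrictions to \<open>P\<close> and \<open>P'\<close>.  Hence \<open>V\<close> and \<open>E Vc D\<close> act in the same
  way on the vector \<open>F\<^sub>* (\<pi> N)\<close>.  Since \<open>F\<^sup>*\<close> maps \<open>P'\<close> onto \<open>P\<close>, the push-forward is injective on
  functionals on \<open>P\<close> (lemma \<open>push_forward_inj_on\<close>), so they act in the same way on \<open>\<pi> N\<close> as well.
  The nodes \<open>\<pi> N\<close> are linearly independent, and a matrix is determined by its action on a linearly
  independent vector (lemma \<open>mat_act_cancel\<close>).
\<close>

lemma length_mat_act [simp]: "length (mat_act A ns) = dim_row A"
  by (simp add: mat_act_def)

lemma nth_mat_act:
  "i < dim_row A \<Longrightarrow> (mat_act A ns ! i) f = (\<Sum>j<dim_col A. A $$ (i, j) * (ns ! j) f)"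
  by (simp add: mat_act_def)

lemma mat_act_mult:
  assumes "dim_col A = dim_row B"
  shows "mat_act A (mat_act B ns) = mat_act (A * B) ns"
proof (rule nth_equalityI)
  fix i assume "i < length (mat_act A (mat_act B ns))"
  then have i: "i < dim_row A" by simp
  show "mat_act A (mat_act B ns) ! i = mat_act (A * B) ns ! i"
  proof
    fix f
    have "(mat_act A (mat_act B ns) ! i) f
        = (\<Sum>l<dim_row B. \<Sum>j<dim_col B. A $$ (i, l) * B $$ (l, j) * (ns ! j) f)"
      using i assms by (simp add: nth_mat_act sum_distrib_left mult.assoc)
    also have "\<dots> = (\<Sum>j<dim_col B. \<Sum>l<dim_row B. A $$ (i, l) * B $$ (l, j) * (ns ! j) f)"
      by (rule sum.swap)
    also have "\<dots> = (mat_act (A * B) ns ! i) f"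
      using i assms
      by (simp add: nth_mat_act scalar_prod_def sum_distrib_right atLeast0LessThan)
    finally show "(mat_act A (mat_act B ns) ! i) f = (mat_act (A * B) ns ! i) f" .
  qed
qed simp

text \<open>
  Each entry of \<open>ms\<close> occurs in \<open>ns\<close>, and only once there, so each row of the Boolean matrix has
  exactly one nonzero entry, which selects that occurrence.
\<close>

lemma mat_act_selection:
  assumes "set ms \<subseteq> set ns" and "distinct ns"
  shows "mat_act (Matrix.mat (length ms) (length ns)
           (\<lambda>(i, j). if ms ! i = ns ! j then 1 else 0)) ns = ms"
proof (rule nth_equalityI)
  let ?E = "Matrix.mat (length ms) (length ns) (\<lambda>(i, j). if ms ! i = ns ! j then 1 else 0)"
  fix i assume "i < length (mat_act ?E ns)"
  then have i: "i < length ms" by simp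
  then obtain m where m: "m < length ns" "ms ! i = ns ! m"
    using assms(1) by (metis in_set_conv_nth nth_mem subsetD)
  show "mat_act ?E ns ! i = ms ! i"
  proof
    fix f
    have "?E $$ (i, j) * (ns ! j) f = (if j = m then (ns ! j) f else 0)"
      if "j < length ns" for j
      using i m that assms(2) by (auto simp: nth_eq_iff_index_eq)
    with i m show "(mat_act ?E ns ! i) f = (ms ! i) f"
      by (simp add: nth_mat_act del: index_mat)
  qed
qed simp

lemma map_restrict0_mat_act:
  assumes "dim_col A = length ns"
  shows "map (restrict0 X) (mat_act A ns) = mat_act A (map (restrict0 X) ns)"
  using assms by (auto intro!: nth_equalityI simp: nth_mat_act restrict0_def fun_eq_iff)

lemma map_push_forward_mat_act:
  assumes "dim_col A = length ns"
  shows "map (push_forward K F X) (mat_act A ns) = mat_act A (map (push_forward K F X) ns)"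
  using assms
  by (auto intro!: nth_equalityI simp: nth_mat_act push_forward_def restrict0_def fun_eq_iff)

text \<open>
  Both sides evaluate \<open>n\<close> at pull-backs of elements of \<open>P'\<close> only, and these pull-backs lie in \<open>P\<close>,
  where \<open>n\<close> agrees with its restriction.
\<close>

lemma restrict0_push_forward:
  assumes "P' \<subseteq> X" and "pull_back K F ` P' \<subseteq> P"
  shows "restrict0 P' (push_forward K F X n) = push_forward K F P' (restrict0 P n)"
  using assms by (auto simp: push_forward_def restrict0_def fun_eq_iff)

text \<open>
  A functional on \<open>P\<close> is recovered from its push-forward because every element of \<open>P\<close> is a pull-back.
  Functionals on \<open>P\<close> are those in the range of \<open>restrict0 P\<close>.
\<close>

lemma push_forward_inj_on:
  assumes "P \<subseteq> pull_back K F ` P'"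
  shows "inj_on (push_forward K F P') (range (restrict0 P))"
proof (rule inj_onI)
  fix m n
  assume mn: "m \<in> range (restrict0 P)" "n \<in> range (restrict0 P)"
    and eq: "push_forward K F P' m = push_forward K F P' n"
  show "m = n"
  proof
    fix g
    show "m g = n g"
    proof (cases "g \<in> P")
      case True
      then obtain f where "f \<in> P'" "g = pull_back K F f"
        using assms by blast
      with fun_cong[OF eq, of f] show ?thesis
        by (simp add: push_forward_def restrict0_def)
    next
      case False
      with mn show ?thesis
        by (auto simp: restrict0_def)
    qed
  qed
qed

lemma sum_fun_apply: "(\<Sum>i\<in>I. h i) x = (\<Sum>i\<in>I. h i x)"
  by (induction I rule: infinite_finite_induct) auto

lemma independent_list_coeff_zero:
  assumes "distinct ns" and "fun_vs.independent (set ns)"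
    and zero: "\<And>f. (\<Sum>j<length ns. c j * (ns ! j) f) = 0" and j: "j < length ns"
  shows "c j = 0"
proof -
  have bij: "bij_betw ((!) ns) {..<length ns} (set ns)"
    using assms(1) by (rule bij_betw_nth) auto
  \<comment> \<open>Distinctness makes the coefficient a function of the list member.\<close>
  define u where "u v = c (the_inv_into {..<length ns} ((!) ns) v)" for v
  have u: "u (ns ! i) = c i" if "i < length ns" for i
    using bij that by (simp add: u_def bij_betw_def the_inv_into_f_f)
  have "(\<Sum>v\<in>set ns. (\<lambda>f. u v * v f)) = (\<Sum>i<length ns. (\<lambda>f. u (ns ! i) * (ns ! i) f))"
    using sum.reindex_bij_betw[OF bij, of "\<lambda>v f. u v * v f"] by simp
  also have "\<dots> = 0"
    using zero by (simp add: fun_eq_iff sum_fun_apply u)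
  finally have "u (ns ! j) = 0"
    using fun_vs.independentD[OF assms(2), of "set ns" u "ns ! j"] j by simp
  with u j show ?thesis by simp
qed

lemma mat_act_cancel:
  assumes "distinct ns" and "fun_vs.independent (set ns)"
    and A: "A \<in> carrier_mat m (length ns)" and B: "B \<in> carrier_mat m (length ns)"
    and eq: "mat_act A ns = mat_act B ns"
  shows "A = B"
proof (rule eq_matI)
  fix i j assume "i < dim_row B" "j < dim_col B"
  then have i: "i < m" and j: "j < length ns" using B by auto
  have "(\<Sum>l<length ns. (A $$ (i, l) - B $$ (i, l)) * (ns ! l) f) = 0" for f
    using arg_cong[OF eq, of "\<lambda>xs. (xs ! i) f"] A B i
    by (simp add: nth_mat_act left_diff_distrib sum_subtractf)
  from independent_list_coeff_zero[OF assms(1,2) this j] show "A $$ (i, j) = B $$ (i, j)"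
    by simp
qed (use A B in auto)

theorem theorem3p3:
  fixes K K' :: "(real ^ 'd::finite) set"
    and P P' :: "(real ^ 'd \<Rightarrow> real) set"
    and N N' Nc Nc' :: "((real ^ 'd \<Rightarrow> real) \<Rightarrow> real) list"
    and F :: "real ^ 'd \<Rightarrow> real ^ 'd"
    and k \<nu> \<mu> :: nat
    and E Vc D V :: "real mat"
  assumes "finite_element k K P N" and "finite_element k K' P' N'"
    and "fun_vs.dim P = \<nu>"
    and "affine_map_on K F" and "bij_betw F K K'"
    and "pull_back K F ` P' = P"
    and "compatible_nodal_completion k K K' F N N' Nc Nc'" and "length Nc = \<mu>"
    and "E = Matrix.mat \<nu> \<mu> (\<lambda>(i, j). if N' ! i = Nc' ! j then 1 else 0)"
    and "Vc \<in> carrier_mat \<mu> \<mu>"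
    and "Nc' = mat_act Vc (map (push_forward K F (Cb k K')) Nc)"
    and "D \<in> carrier_mat \<mu> \<nu>"
    and "map (restrict0 P) Nc = mat_act D (map (restrict0 P) N)"
    and "V \<in> carrier_mat \<nu> \<nu>"
    and "map (restrict0 P') N' = mat_act V (map (push_forward K F P') (map (restrict0 P) N))"
  shows "V = E * Vc * D"
proof -
  let ?\<pi> = "map (restrict0 P)" and ?\<pi>' = "map (restrict0 P')"
  let ?F = "map (push_forward K F P')" and ?G = "map (push_forward K F (Cb k K'))"
  have fe: "length N = fun_vs.dim P" "distinct (?\<pi> N)" "fun_vs.independent (restrict0 P ` set N)"
    and sub: "P' \<subseteq> Cb k K'"
    using assms(1,2) by (auto simp: finite_element_def)
  have cnc: "set N' \<subseteq> set Nc'" "distinct Nc'" "length Nc = length Nc'"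
    using assms(7) by (auto simp: compatible_nodal_completion_def)
  have len: "length N = \<nu>" "length Nc' = \<mu>"
    using fe(1) assms(3,8) cnc(3) by simp_all
  have lenN': "length N' = \<nu>"
    using arg_cong[OF assms(15), of length] assms(14) by simp
  have E: "E \<in> carrier_mat \<nu> \<mu>"
    using assms(9) by simp
  have W: "E * Vc * D \<in> carrier_mat \<nu> \<nu>"
    using E assms(10,12) by simp
  have "N' = mat_act E Nc'"
    using mat_act_selection[OF cnc(1,2)] assms(9) len lenN' by simp
  also have "\<dots> = mat_act (E * Vc) (?G Nc)"
    using E assms(10) by (subst assms(11)) (simp add: mat_act_mult)
  finally have "?\<pi>' N' = mat_act (E * Vc) (?\<pi>' (?G Nc))"
    using assms(8,10) by (simp add: map_restrict0_mat_act)
  also have "?\<pi>' (?G Nc) = ?F (?\<pi> Nc)"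
    using restrict0_push_forward[OF sub, of K F P] assms(6) by simp
  also have "mat_act (E * Vc) (?F (?\<pi> Nc)) = mat_act (E * Vc * D) (?F (?\<pi> N))"
    using E assms(10,12) len(1)
    by (subst assms(13)) (simp add: map_push_forward_mat_act mat_act_mult)
  finally have "mat_act V (?F (?\<pi> N)) = mat_act (E * Vc * D) (?F (?\<pi> N))"
    using assms(15) by simp
  moreover have comm: "mat_act A (?\<pi> N) = ?\<pi> (mat_act A N)"
    "mat_act A (?F (?\<pi> N)) = ?F (?\<pi> (mat_act A N))" if "A \<in> carrier_mat \<nu> \<nu>" for A
    using that len(1)
    by (simp_all add: map_push_forward_mat_act map_restrict0_mat_act del: map_map)
  ultimately have "?F (?\<pi> (mat_act V N)) = ?F (?\<pi> (mat_act (E * Vc * D) N))"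
    using assms(14) W by metis
  then have "?\<pi> (mat_act V N) = ?\<pi> (mat_act (E * Vc * D) N)"
    by (rule map_inj_on)
      (use push_forward_inj_on[of P K F P'] assms(6) in \<open>auto intro: inj_on_subset\<close>)
  then have "mat_act V (?\<pi> N) = mat_act (E * Vc * D) (?\<pi> N)"
    using comm(1) assms(14) W by metis
  then show ?thesis
    using mat_act_cancel[of "?\<pi> N" V \<nu> "E * Vc * D"] fe assms(14) W len(1) by simp
qed

end
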